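(* Let $E$ be a unital Banach algebra, $a<b$, and let $\mathcal I$ be the set of all compact subintervals of $[a,b]$. Assume that $A:[a,b]\to E$ is a regulated function such that $I+\Delta^+A(t)$ is invertible for all $t\in[a,b)$, and $I-\Delta^-A(t)$ is invertible for all $t\in(a,b]$. Let $V:[a,b]\times\mathcal I\to E$ be given by $$V(\xi,[x,y])=(I+A(y)-A(\xi))(I+A(x)-A(\xi))^{-1}.$$ Then the following statements are equivalent: 1. $V$ is strongly Kurzweil product integrable. 2. The linear generalized differential equation $$x(t)=x(a)+\int_a^tD_s[A(s)]x(s),\quad t\in[a,b],$$ has a strong Kurzweil-Henstock solution $W:[a,b]\to E$ such that $W(t)^{-1}$ exists for all $t\in[a,b]$, and both $W$ and $W^{-1}$ are bounded.
   Context: A unital Banach algebra is a complete normed algebra with unit $I$, $\|I\|=1$. $A$ is regulated if it has left limits $A(t-)$ at all $t\in(a,b]$ and right limits $A(t+)$ at all $t\in[a,b)$; $\Delta^+A(t)=A(t+)-A(t)$, $\Delta^-A(t)=A(t)-A(t-)$. The values $V(\xi,[x,y])$ matter only for $x\le\xi\le y$ with $x,y$ sufficiently close to $\xi$ (only such values occur for $\delta$-fine tagged partitions with a sufficiently small gauge $\delta$); by the hypothesis on $I-\Delta^-A$, for each $\xi$ the inverse exists for all $x\le\xi$ sufficiently close to $\xi$. Where the inverse does not exist, $V$ may be defined arbitrarily. A gauge is a function $\delta:[a,b]\to\mathbb R^+$. Tagged partition of $[a,b]$: $(\xi_i,[t_{i-1},t_i])_{i=1}^m$ with $a=t_0<\dots<t_m=b$,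 $\xi_i\in[t_{i-1},t_i]$; it is $\delta$-fine if $[t_{i-1},t_i]\subset(\xi_i-\delta(\xi_i),\xi_i+\delta(\xi_i))$ for all $i$. $V$ is strongly Kurzweil product integrable if there is $W_0:[a,b]\to E$ with $W_0(t)$ invertible for all $t$, $W_0$ and $W_0^{-1}$ bounded, such that for every $\varepsilon>0$ there is a gauge $\delta$ with $\sum_{i=1}^m\|V(\xi_i,[t_{i-1},t_i])-W_0(t_i)W_0(t_{i-1})^{-1}\|<\varepsilon$ for every $\delta$-fine tagged partition of $[a,b]$. Strong Kurzweil-Henstock solution: $x:[a,b]\to E$ is a strong Kurzweil-Henstock solution of the equation in statement 2 if for every $\varepsilon>0$ there is a gauge $\delta$ such that $\sum_{i=1}^m\|x(t_i)-x(t_{i-1})-(A(t_i)-A(t_{i-1}))x(\xi_i)\|<\varepsilon$ for every $\delta$-fine tagged partition of $[a,b]$. *)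

theory Defs
  imports "HOL-Analysis.Analysis"
begin

text \<open>
  Functions on the interval from \<open>a\<close> to \<open>b\<close> are total functions on the reals; every notion below
  depends only on their values on that interval.
  A unital Banach algebra is a type of class \<open>real_normed_algebra_1\<close> and \<open>banach\<close>: completeness and
  \<open>norm 1 = 1\<close> are part of these classes, and complex algebras are covered by restriction of
  scalars. The multiplication need not be commutative, so inverses are two-sided inverses in the
  multiplicative monoid (the class operation \<open>inverse\<close> is not available).
\<close>

definition invertible_elt :: "'a::monoid_mult \<Rightarrow> bool" where
  "invertible_elt x \<longleftrightarrow> (\<exists>y. x * y = 1 \<and> y * x = 1)"

definition inverse_elt :: "'a::monoid_mult \<Rightarrow> 'a" where
  "inverse_elt x = (THE y. x * y = 1 \<and> y * x = 1)"

definition regulated_on :: "real \<Rightarrow> real \<Rightarrow> (real \<Rightarrow> 'a::topological_space) \<Rightarrow> bool" where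
  "regulated_on a b A \<longleftrightarrow>
     (\<forall>t\<in>{a<..b}. \<exists>l. (A \<longlongrightarrow> l) (at_left t)) \<and>
     (\<forall>t\<in>{a..<b}. \<exists>l. (A \<longlongrightarrow> l) (at_right t))"

definition right_jump :: "(real \<Rightarrow> 'a::real_normed_vector) \<Rightarrow> real \<Rightarrow> 'a" where
  "right_jump A t = Lim (at_right t) A - A t"

definition left_jump :: "(real \<Rightarrow> 'a::real_normed_vector) \<Rightarrow> real \<Rightarrow> 'a" where
  "left_jump A t = A t - Lim (at_left t) A"

text \<open>
  The library's gauges and tagged divisions are set-valued and admit degenerate pieces, whereas
  here gauges are positive functions and tagged partitions are ordered and nondegenerate. Of a
  partition, only the points \<open>t 0, \<dots>, t m\<close> and the tags \<open>\<xi> 1, \<dots>, \<xi> m\<close> are relevant.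
\<close>

definition gauge_on :: "real \<Rightarrow> real \<Rightarrow> (real \<Rightarrow> real) \<Rightarrow> bool" where
  "gauge_on a b \<delta> \<longleftrightarrow> (\<forall>s\<in>{a..b}. \<delta> s > 0)"

definition tagged_partition ::
    "real \<Rightarrow> real \<Rightarrow> nat \<Rightarrow> (nat \<Rightarrow> real) \<Rightarrow> (nat \<Rightarrow> real) \<Rightarrow> bool" where
  "tagged_partition a b m \<xi> t \<longleftrightarrow>
     t 0 = a \<and> t m = b \<and>
     (\<forall>i\<in>{1..m}. t (i - 1) < t i \<and> \<xi> i \<in> {t (i - 1)..t i})"

definition fine_partition ::
    "(real \<Rightarrow> real) \<Rightarrow> nat \<Rightarrow> (nat \<Rightarrow> real) \<Rightarrow> (nat \<Rightarrow> real) \<Rightarrow> bool" where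
  "fine_partition \<delta> m \<xi> t \<longleftrightarrow>
     (\<forall>i\<in>{1..m}. {t (i - 1)..t i} \<subseteq> {\<xi> i - \<delta> (\<xi> i)<..<\<xi> i + \<delta> (\<xi> i)})"

definition strongly_Kurzweil_product_integrable ::
    "real \<Rightarrow> real \<Rightarrow> (real \<Rightarrow> real set \<Rightarrow> 'a::{real_normed_algebra_1,banach}) \<Rightarrow> bool" where
  "strongly_Kurzweil_product_integrable a b V \<longleftrightarrow>
     (\<exists>W\<^sub>0.
        (\<forall>t\<in>{a..b}. invertible_elt (W\<^sub>0 t)) \<and>
        bounded (W\<^sub>0 ` {a..b}) \<and>
        bounded ((\<lambda>t. inverse_elt (W\<^sub>0 t)) ` {a..b}) \<and>
        (\<forall>\<epsilon>>0. \<exists>\<delta>. gauge_on a b \<delta> \<and>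
           (\<forall>m \<xi> t. tagged_partition a b m \<xi> t \<and> fine_partition \<delta> m \<xi> t \<longrightarrow>
              (\<Sum>i=1..m. norm (V (\<xi> i) {t (i - 1)..t i}
                              - W\<^sub>0 (t i) * inverse_elt (W\<^sub>0 (t (i - 1))))) < \<epsilon>)))"

text \<open>Strong Kurzweil-Henstock solution of
  \<open>x(t) = x(a) + \<integral>\<^sub>a\<^sup>t D\<^sub>s[A(s)] x(s)\<close> on the interval from \<open>a\<close> to \<open>b\<close>.\<close>

definition strong_KH_solution ::
    "real \<Rightarrow> real \<Rightarrow> (real \<Rightarrow> 'a::{real_normed_algebra_1,banach}) \<Rightarrow> (real \<Rightarrow> 'a) \<Rightarrow> bool" where
  "strong_KH_solution a b A x \<longleftrightarrow>
     (\<forall>\<epsilon>>0. \<exists>\<delta>. gauge_on a b \<delta> \<and>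
        (\<forall>m \<xi> t. tagged_partition a b m \<xi> t \<and> fine_partition \<delta> m \<xi> t \<longrightarrow>
           (\<Sum>i=1..m. norm (x (t i) - x (t (i - 1))
                           - (A (t i) - A (t (i - 1))) * x (\<xi> i))) < \<epsilon>))"

end

theory Submission
  imports Defs
begin

text \<open>
  With \<open>P = 1 + A y - A \<xi>\<close> and \<open>Q = 1 + A x - A \<xi>\<close>, both conditions say that \<open>W y \<approx> P W \<xi>\<close> and
  \<open>W x \<approx> Q W \<xi>\<close> with a summable error. Indeed, cutting every interval of a fine partition at its tag
  keeps it fine and separates the two factors of \<open>V\<close>, respectively the two halves of the Stieltjes
  increment. The errors of the two conditions then differ by factors containing \<open>P\<close>, \<open>Q\<close> and
  \<open>Q\<^sup>-\<^sup>1\<close>; these are bounded uniformly in \<open>\<xi>\<close> because \<open>W\<close> and \<open>W\<^sup>-\<^sup>1\<close> are bounded and the errors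
  themselves are small.
\<close>

section \<open>Inverses in a Banach algebra\<close>

lemma inverse_elt_unique:
  fixes x :: "'a::monoid_mult"
  assumes "x * y = 1" "y * x = 1"
  shows "inverse_elt x = y"
  unfolding inverse_elt_def
proof (rule the_equality)
  show "z = y" if "x * z = 1 \<and> z * x = 1" for z
    using that assms by (metis mult.assoc mult_1 mult.right_neutral)
qed (use assms in blast)

lemma inverse_elt:
  fixes x :: "'a::monoid_mult"
  assumes "invertible_elt x"
  shows "x * inverse_elt x = 1" "inverse_elt x * x = 1"
  using assms inverse_elt_unique unfolding invertible_elt_def by metis+

lemma invertible_elt_one: "invertible_elt (1::'a::monoid_mult)"
  unfolding invertible_elt_def by auto

lemma inverse_elt_one: "inverse_elt (1::'a::monoid_mult) = 1"
  by (rule inverse_elt_unique) auto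

lemma invertible_elt_mult:
  fixes x y :: "'a::monoid_mult"
  assumes "invertible_elt x" "invertible_elt y"
  shows "invertible_elt (x * y)"
proof -
  obtain x' y' where "x * x' = 1" "x' * x = 1" "y * y' = 1" "y' * y = 1"
    using assms unfolding invertible_elt_def by blast
  then have "x * y * (y' * x') = 1" "y' * x' * (x * y) = 1"
    by (metis mult.assoc mult.right_neutral)+
  then show ?thesis unfolding invertible_elt_def by blast
qed

text \<open>Neumann series: the powers of \<open>s\<close> are dominated by a geometric series, and
  splitting off the first term of the sum gives \<open>y = 1 + s * y = 1 + y * s\<close>.\<close>

lemma invertible_elt_one_minus:
  fixes s :: "'a::{real_normed_algebra_1,banach}"
  assumes "norm s < 1"
  shows "invertible_elt (1 - s)"
proof -
  have summ: "summable (\<lambda>n. s ^ n)"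
  proof (rule summable_norm_cancel, rule summable_comparison_test')
    show "summable (\<lambda>n. norm s ^ n)" using assms by (intro summable_geometric) simp
  qed (simp add: norm_power_ineq)
  define y where "y = (\<Sum>n. s ^ n)"
  have split: "y = 1 + (\<Sum>n. s ^ Suc n)"
    unfolding y_def using suminf_split_head[OF summ] by simp
  have "(\<Sum>n. s ^ Suc n) = s * y"
    unfolding y_def using suminf_mult[OF summ, of s] by simp
  moreover have "(\<Sum>n. s ^ Suc n) = y * s"
    unfolding y_def using suminf_mult2[OF summ, of s] by (simp add: power_commutes)
  ultimately have "(1 - s) * y = 1" "y * (1 - s) = 1"
    using split by (simp_all add: algebra_simps)
  then show ?thesis unfolding invertible_elt_def by blast
qed

text \<open>The units form an open set: \<open>f x\<close> is \<open>l\<close> times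
  \<open>1 - (1 - inverse_elt l * f x)\<close>, and the inner difference tends to \<open>0\<close>,
  so the Neumann series eventually applies.\<close>

lemma eventually_invertible_elt:
  fixes f :: "'b \<Rightarrow> 'a::{real_normed_algebra_1,banach}"
  assumes lim: "(f \<longlongrightarrow> l) F" and inv: "invertible_elt l"
  shows "\<forall>\<^sub>F x in F. invertible_elt (f x)"
proof -
  let ?k = "inverse_elt l"
  have "((\<lambda>x. norm (1 - ?k * f x)) \<longlongrightarrow> norm (1 - ?k * l)) F"
    by (intro tendsto_intros lim)
  then have "\<forall>\<^sub>F x in F. norm (1 - ?k * f x) < 1"
    by (rule order_tendstoD) (simp add: inverse_elt(2)[OF inv])
  then show ?thesis
  proof eventually_elim
    case (elim x)
    have "invertible_elt (l * (1 - (1 - ?k * f x)))"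
      using invertible_elt_mult[OF inv invertible_elt_one_minus[OF elim]] .
    moreover have "l * (1 - (1 - ?k * f x)) = f x"
      by (simp add: mult.assoc[symmetric] inverse_elt(1)[OF inv])
    ultimately show ?case by simp
  qed
qed

text \<open>As \<open>x\<close> increases to \<open>s > a\<close>, \<open>1 + A x - A s\<close>
  tends to \<open>1 - left_jump A s\<close>, a unit by assumption. The resulting one-sided
  neighbourhoods form a gauge under which the formula for \<open>V\<close> is meaningful.\<close>

lemma regulated_on_gauge_invertible:
  fixes A :: "real \<Rightarrow> 'a::{real_normed_algebra_1,banach}"
  assumes reg: "regulated_on a b A"
    and inv: "\<And>t. t \<in> {a<..b} \<Longrightarrow> invertible_elt (1 - left_jump A t)"
  obtains \<delta> where "gauge_on a b \<delta>"
    "\<And>s x. \<lbrakk>s \<in> {a..b}; a \<le> x; x \<le> s; s - \<delta> s < x\<rbrakk> \<Longrightarrow> invertible_elt (1 + A x - A s)"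
proof -
  have "\<exists>d>0. \<forall>x. a \<le> x \<and> x \<le> s \<and> s - d < x \<longrightarrow> invertible_elt (1 + A x - A s)"
    if s: "s \<in> {a..b}" for s
  proof (cases "s = a")
    case True
    \<comment> \<open>Here \<open>x = s = a\<close> is forced, so the element is \<open>1\<close>
      and any radius will do.\<close>
    then show ?thesis by (auto intro!: exI[of _ 1] simp: invertible_elt_one)
  next
    case False
    with s have s': "s \<in> {a<..b}" by auto
    with reg obtain l where l: "(A \<longlongrightarrow> l) (at_left s)" unfolding regulated_on_def by blast
    then have "Lim (at_left s) A = l" by (intro tendsto_Lim) auto
    with inv[OF s'] have "invertible_elt (1 + l - A s)"
      by (simp add: left_jump_def algebra_simps)
    moreover have "((\<lambda>x. 1 + A x - A s) \<longlongrightarrow> 1 + l - A s) (at_left s)"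
      by (intro tendsto_intros l)
    ultimately have "\<forall>\<^sub>F x in at_left s. invertible_elt (1 + A x - A s)"
      by (intro eventually_invertible_elt)
    then obtain c where c: "c < s" "\<And>x. c < x \<Longrightarrow> x < s \<Longrightarrow> invertible_elt (1 + A x - A s)"
      unfolding eventually_at_left_field by blast
    \<comment> \<open>The left neighbourhood excludes \<open>s\<close> itself, where the element is
      \<open>1\<close>.\<close>
    have "invertible_elt (1 + A x - A s)" if "x \<le> s" "s - (s - c) < x" for x
      using c(2)[of x] that by (cases "x = s") (auto simp: invertible_elt_one)
    with c(1) show ?thesis by (intro exI[of _ "s - c"]) auto
  qed
  then obtain \<delta> where "\<And>s. s \<in> {a..b} \<Longrightarrow> \<delta> s > 0 \<and>
      (\<forall>x. a \<le> x \<and> x \<le> s \<and> s - \<delta> s < x \<longrightarrow> invertible_elt (1 + A x - A s))"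
    by metis
  then show ?thesis by (intro that[of \<delta>]) (auto simp: gauge_on_def)
qed

lemma bounded_images_common_bound:
  fixes f :: "'b \<Rightarrow> 'c::real_normed_vector" and g :: "'b \<Rightarrow> 'd::real_normed_vector"
  assumes "bounded (f ` S)" "bounded (g ` S)"
  obtains M :: real where "M \<ge> 1" "\<And>t. t \<in> S \<Longrightarrow> norm (f t) \<le> M" "\<And>t. t \<in> S \<Longrightarrow> norm (g t) \<le> M"
proof -
  obtain B C where "\<And>t. t \<in> S \<Longrightarrow> norm (f t) \<le> B" "\<And>t. t \<in> S \<Longrightarrow> norm (g t) \<le> C"
    using assms unfolding bounded_iff by auto
  then show ?thesis
    by (intro that[of "max 1 (max B C)"]) (auto simp: le_max_iff_disj)
qed

section \<open>Sums over fine partitions\<close>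

definition partition_sum ::
    "(real \<Rightarrow> real \<Rightarrow> real \<Rightarrow> real) \<Rightarrow> nat \<Rightarrow> (nat \<Rightarrow> real) \<Rightarrow> (nat \<Rightarrow> real) \<Rightarrow> real" where
  "partition_sum g m \<xi> t = (\<Sum>i=1..m. g (\<xi> i) (t (i - 1)) (t i))"

text \<open>Both strong notions take this form once \<open>g\<close> is the norm of their local
  error, read as a function of the tag, the left and the right endpoint. One transfer argument can
  then serve both directions of the equivalence.\<close>

definition null_sums :: "real \<Rightarrow> real \<Rightarrow> (real \<Rightarrow> real \<Rightarrow> real \<Rightarrow> real) \<Rightarrow> bool" where
  "null_sums a b g \<longleftrightarrow> (\<forall>\<epsilon>>0. \<exists>\<delta>. gauge_on a b \<delta> \<and>
     (\<forall>m \<xi> t. tagged_partition a b m \<xi> t \<and> fine_partition \<delta> m \<xi> t \<longrightarrow>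
        partition_sum g m \<xi> t < \<epsilon>))"

lemma tagged_partition_bounds:
  assumes "tagged_partition a b m \<xi> t" "i \<in> {1..m}"
  shows "a \<le> t (i - 1)" "t (i - 1) \<le> \<xi> i" "\<xi> i \<le> t i" "t i \<le> b"
proof -
  have less: "t (k - 1) < t k" if "k \<in> {1..m}" for k
    using assms(1) that unfolding tagged_partition_def by auto
  have mono: "t j \<le> t k" if "j \<le> k" "k \<le> m" for j k
    using that
  proof (induction k rule: dec_induct)
    case (step n)
    then show ?case using less[of "Suc n"] by auto
  qed simp
  show "a \<le> t (i - 1)" "t i \<le> b"
    using mono[of 0 "i - 1"] mono[of i m] assms unfolding tagged_partition_def by auto
  show "t (i - 1) \<le> \<xi> i" "\<xi> i \<le> t i"
    using assms unfolding tagged_partition_def by auto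
qed

text \<open>Partitions are nondegenerate, yet a tag may be an endpoint of its interval, and then one
  half of the cut interval is a single point. In that case nothing is appended, and the vanishing of
  \<open>g\<close> there keeps the sum right.\<close>

lemma fine_partition_append:
  assumes part: "tagged_partition a c m \<xi> t" "fine_partition \<delta> m \<xi> t"
    and piece: "c \<le> d" "s \<in> {c..d}" "{c..d} \<subseteq> {s - \<delta> s<..<s + \<delta> s}"
    and degenerate: "c = d \<Longrightarrow> g s c d = 0"
  obtains m' \<xi>' t' where "tagged_partition a d m' \<xi>' t'" "fine_partition \<delta> m' \<xi>' t'"
    "partition_sum g m' \<xi>' t' = partition_sum g m \<xi> t + g s c d"
proof (cases "c = d")
  case True
  then show ?thesis using that[of m \<xi> t] part degenerate by simp
next
  case False
  define \<xi>' where "\<xi>' = \<xi>(Suc m := s)"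
  define t' where "t' = t(Suc m := d)"
  have eq: "\<xi>' i = \<xi> i" "t' i = t i" "t' (i - Suc 0) = t (i - Suc 0)" if "i \<in> {1..m}" for i
    using that by (auto simp: \<xi>'_def t'_def)
  have new: "\<xi>' (Suc m) = s" "t' (Suc m) = d" "t' m = c" "t' 0 = a"
    using part(1) by (auto simp: \<xi>'_def t'_def tagged_partition_def)
  have Suc: "{1..Suc m} = insert (Suc m) {1..m}" by auto
  have "tagged_partition a d (Suc m) \<xi>' t'"
    using part(1) False piece unfolding tagged_partition_def Suc ball_simps by (simp add: eq new)
  moreover have "fine_partition \<delta> (Suc m) \<xi>' t'"
    using part(2) piece(3) unfolding fine_partition_def Suc ball_simps by (simp add: eq new)
  moreover have "partition_sum g (Suc m) \<xi>' t' = partition_sum g m \<xi> t + g s c d"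
    unfolding partition_sum_def by (simp add: eq new)
  ultimately show ?thesis by (rule that)
qed

text \<open>Each half of a cut interval keeps the original tag and lies inside the original
  interval, so fineness survives with the same gauge. The induction removes the last interval, which
  changes the right endpoint; hence \<open>b\<close> is generalized.\<close>

lemma fine_partition_cut_at_tags:
  assumes "tagged_partition a b m \<xi> t" "fine_partition \<delta> m \<xi> t"
    and "\<And>s. s \<in> {a..b} \<Longrightarrow> g s s s = 0"
  shows "\<exists>m' \<xi>' t'. tagged_partition a b m' \<xi>' t' \<and> fine_partition \<delta> m' \<xi>' t' \<and>
    partition_sum g m' \<xi>' t' = partition_sum (\<lambda>s x y. g s x s + g s s y) m \<xi> t"
  using assms
proof (induction m arbitrary: b)
  case 0
  then show ?case
    by (intro exI[of _ 0] exI[of _ \<xi>] exI[of _ t]) (auto simp: partition_sum_def)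
next
  case (Suc m)
  define c s where "c = t m" and "s = \<xi> (Suc m)"
  have bounds: "a \<le> c" "c \<le> s" "s \<le> b"
    using tagged_partition_bounds[OF Suc.prems(1), of "Suc m"] by (auto simp: c_def s_def)
  have tm: "t (Suc m) = b" using Suc.prems(1) by (simp add: tagged_partition_def)
  have fine: "{c..b} \<subseteq> {s - \<delta> s<..<s + \<delta> s}"
    using Suc.prems(2)[unfolded fine_partition_def, rule_format, of "Suc m"] tm
    by (simp add: c_def s_def)
  have "tagged_partition a c m \<xi> t" "fine_partition \<delta> m \<xi> t"
    using Suc.prems by (auto simp: tagged_partition_def fine_partition_def c_def)
  then obtain m1 \<xi>1 t1 where p1: "tagged_partition a c m1 \<xi>1 t1" "fine_partition \<delta> m1 \<xi>1 t1"
    "partition_sum g m1 \<xi>1 t1 = partition_sum (\<lambda>s x y. g s x s + g s s y) m \<xi> t"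
    using Suc.IH[of c] Suc.prems(3) bounds by force
  have zero: "g s s s = 0" using Suc.prems(3) bounds by auto
  obtain m2 \<xi>2 t2 where p2: "tagged_partition a s m2 \<xi>2 t2" "fine_partition \<delta> m2 \<xi>2 t2"
    "partition_sum g m2 \<xi>2 t2 = partition_sum g m1 \<xi>1 t1 + g s c s"
    by (rule fine_partition_append[OF p1(1,2), of s s g]) (use bounds fine zero in auto)
  obtain m3 \<xi>3 t3 where p3: "tagged_partition a b m3 \<xi>3 t3" "fine_partition \<delta> m3 \<xi>3 t3"
    "partition_sum g m3 \<xi>3 t3 = partition_sum g m2 \<xi>2 t2 + g s s b"
    by (rule fine_partition_append[OF p2(1,2), of b s g]) (use bounds fine zero in auto)
  have "partition_sum g m3 \<xi>3 t3 = partition_sum (\<lambda>s x y. g s x s + g s s y) (Suc m) \<xi> t"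
    using p1(3) p2(3) p3(3) tm by (simp add: partition_sum_def c_def s_def)
  with p3(1,2) show ?case by blast
qed

text \<open>The pointwise estimate \<open>le\<close> may presuppose small errors on both halves,
  because for nonnegative \<open>g\<close> a single term never exceeds the whole sum. The errors on
  the halves add up to the sum of \<open>g\<close> over the partition cut at its tags, which is
  again fine.\<close>

lemma null_sums_transfer:
  assumes g: "null_sums a b g" "\<And>s x y. 0 \<le> g s x y" "\<And>s. s \<in> {a..b} \<Longrightarrow> g s s s = 0"
    and gauge: "gauge_on a b \<delta>\<^sub>0" and pos: "r > 0" "C > 0"
    and le: "\<And>s x y. \<lbrakk>a \<le> x; x \<le> s; s \<le> y; y \<le> b; s - \<delta>\<^sub>0 s < x;
                g s x s \<le> r; g s s y \<le> r\<rbrakk> \<Longrightarrow> h s x y \<le> C * (g s x s + g s s y)"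
  shows "null_sums a b h"
  unfolding null_sums_def
proof (intro allI impI)
  fix \<epsilon> :: real assume "\<epsilon> > 0"
  define k where "k = (\<lambda>s x y. g s x s + g s s y)"
  \<comment> \<open>The bound \<open>r\<close> makes \<open>le\<close> applicable on every interval;
    \<open>\<epsilon> / C\<close> compensates for the factor \<open>C\<close>.\<close>
  have "min r (\<epsilon> / C) > 0" using \<open>\<epsilon> > 0\<close> pos by simp
  then obtain \<delta>\<^sub>1 where d1: "gauge_on a b \<delta>\<^sub>1"
    "\<And>m \<xi> t. tagged_partition a b m \<xi> t \<Longrightarrow> fine_partition \<delta>\<^sub>1 m \<xi> t \<Longrightarrow>
       partition_sum g m \<xi> t < min r (\<epsilon> / C)"
    using g(1) unfolding null_sums_def by blast
  define \<delta> where "\<delta> = (\<lambda>s. min (\<delta>\<^sub>0 s) (\<delta>\<^sub>1 s))"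
  show "\<exists>\<delta>. gauge_on a b \<delta> \<and> (\<forall>m \<xi> t. tagged_partition a b m \<xi> t \<and> fine_partition \<delta> m \<xi> t \<longrightarrow>
        partition_sum h m \<xi> t < \<epsilon>)"
  proof (intro exI[of _ \<delta>] conjI allI impI; (elim conjE)?)
    show "gauge_on a b \<delta>" using gauge d1(1) by (auto simp: gauge_on_def \<delta>_def)
    fix m \<xi> t assume p: "tagged_partition a b m \<xi> t" "fine_partition \<delta> m \<xi> t"
    have fine: "fine_partition \<delta>\<^sub>0 m \<xi> t" "fine_partition \<delta>\<^sub>1 m \<xi> t"
      using p(2) unfolding fine_partition_def \<delta>_def by fastforce+
    have small: "partition_sum k m \<xi> t < min r (\<epsilon> / C)"
      using fine_partition_cut_at_tags[where g = g, OF p(1) fine(2) g(3)] d1(2) unfolding k_def by metis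
    have k0: "0 \<le> k s x y" for s x y using g(2) by (simp add: k_def)
    have "h (\<xi> i) (t (i - 1)) (t i) \<le> C * k (\<xi> i) (t (i - 1)) (t i)" if i: "i \<in> {1..m}" for i
    proof -
      have "k (\<xi> i) (t (i - 1)) (t i) \<le> partition_sum k m \<xi> t"
        unfolding partition_sum_def
        using member_le_sum[of i "{1..m}" "\<lambda>i. k (\<xi> i) (t (i - 1)) (t i)"] i k0 by simp
      then have "g (\<xi> i) (t (i - 1)) (\<xi> i) + g (\<xi> i) (\<xi> i) (t i) \<le> r"
        using small by (simp add: k_def)
      then have "g (\<xi> i) (t (i - 1)) (\<xi> i) \<le> r" "g (\<xi> i) (\<xi> i) (t i) \<le> r"
        using g(2)[of "\<xi> i" "t (i - 1)" "\<xi> i"] g(2)[of "\<xi> i" "\<xi> i" "t i"] by linarith+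
      moreover have "\<xi> i - \<delta>\<^sub>0 (\<xi> i) < t (i - 1)"
        using subsetD[OF fine(1)[unfolded fine_partition_def, rule_format, OF i], of "t (i - 1)"]
          tagged_partition_bounds[OF p(1) i] by simp
      ultimately show ?thesis
        unfolding k_def using tagged_partition_bounds[OF p(1) i] by (intro le) auto
    qed
    then have "partition_sum h m \<xi> t \<le> C * partition_sum k m \<xi> t"
      unfolding partition_sum_def sum_distrib_left by (intro sum_mono)
    also have "\<dots> < \<epsilon>" using small pos by (simp add: field_simps)
    finally show "partition_sum h m \<xi> t < \<epsilon>" .
  qed
qed

section \<open>Comparison of the error terms\<close>

lemma norm_mult_bound:
  fixes x y :: "'a::real_normed_algebra"
  assumes "norm x \<le> p" "norm y \<le> q"
  shows "norm (x * y) \<le> p * q"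
proof -
  have "norm x * norm y \<le> p * q"
    using assms by (intro mult_mono) (auto intro: order_trans[OF norm_ge_zero])
  then show ?thesis using norm_mult_ineq[of x y] by linarith
qed

text \<open>The term \<open>q * z\<close> contributes at most half of \<open>norm q\<close> and is
  absorbed on the left. This is how \<open>Q\<close> and its inverse get bounds that do not depend
  on the tag.\<close>

lemma norm_le_absorb:
  fixes q c z :: "'a::real_normed_algebra"
  assumes "q = c + q * z" "norm z \<le> 1 / 2"
  shows "norm q \<le> 2 * norm c"
proof -
  have "norm q \<le> norm c + norm (q * z)"
    using assms(1) norm_triangle_ineq[of c "q * z"] by metis
  also have "norm (q * z) \<le> norm q * (1 / 2)"
    by (rule norm_mult_bound) (use assms in auto)
  finally show ?thesis by simp
qed

text \<open>To be read with \<open>u\<close>, \<open>v\<close>, \<open>w\<close> as the values of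
  \<open>W\<close> at the left endpoint, the right endpoint and the tag, with \<open>p\<close>,
  \<open>q\<close> as \<open>P\<close>, \<open>Q\<close>, and with primes for inverses. For
  \<open>s = q' - w * u'\<close> the difference splits as
  \<open>- ((p - v * w') * w) - q * s * u\<close>, so only \<open>q\<close> needs a bound beyond
  those given.\<close>

lemma KH_error_le_product_error:
  fixes u v w u' w' p q q' :: "'a::real_normed_algebra_1"
  assumes inv: "u * u' = 1" "u' * u = 1" "w * w' = 1" "w' * w = 1" "q * q' = 1" "q' * q = 1"
    and M: "M \<ge> 1" "norm u \<le> M" "norm w \<le> M" "norm w' \<le> M"
    and small: "norm (q' - w * u') \<le> 1 / (2 * M\<^sup>2)"
  shows "norm (v - u - (p - q) * w)
    \<le> 2 * M ^ 3 * (norm (q' - w * u') + norm (p - v * w'))"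
proof -
  define s where "s = q' - w * u'"
  \<comment> \<open>Since \<open>q * s = 1 - q * w * u'\<close>, multiplication by
    \<open>u * w'\<close> on the right gives \<open>u * w' - q\<close>.\<close>
  have "q = u * w' + q * - (s * (u * w'))"
  proof -
    have "q * (s * (u * w')) = u * w' - q * (w * (u' * u) * w')"
      by (simp add: s_def algebra_simps) (simp add: mult.assoc[symmetric] inv)
    then show ?thesis by (simp add: inv)
  qed
  moreover have uw: "norm (u * w') \<le> M * M" by (intro norm_mult_bound M)
  \<comment> \<open>The threshold \<open>1 / (2 * M\<^sup>2)\<close> is chosen so that the factor
    \<open>norm (u * w') \<le> M * M\<close> leaves \<open>1 / 2\<close>.\<close>
  moreover have "norm (- (s * (u * w'))) \<le> 1 / 2"
    using norm_mult_bound[OF small[folded s_def] uw] M(1) by (simp add: power2_eq_square)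
  ultimately have "norm q \<le> 2 * M\<^sup>2"
    using norm_le_absorb[of q "u * w'"] by (fastforce simp: power2_eq_square)
  then have "norm (q * s * u) \<le> 2 * M\<^sup>2 * norm s * M"
    by (intro norm_mult_bound M) auto
  moreover have "norm ((p - v * w') * w) \<le> norm (p - v * w') * M"
    by (intro norm_mult_bound M) auto
  moreover have "v - u - (p - q) * w = - ((p - v * w') * w) - q * s * u"
  proof -
    have "q * s * u = (q * q') * u - q * w * (u' * u)"
      by (simp add: s_def algebra_simps)
    then have "q * s * u = u - q * w" by (simp add: inv)
    moreover have "(p - v * w') * w = p * w - v"
      by (simp add: algebra_simps inv)
    ultimately show ?thesis by (simp add: algebra_simps)
  qed
  ultimately have "norm (v - u - (p - q) * w) \<le> norm (p - v * w') * M + 2 * M\<^sup>2 * norm s * M"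
    using norm_triangle_ineq4[of "- ((p - v * w') * w)" "q * s * u"] by simp
  moreover have "norm (p - v * w') * M \<le> norm (p - v * w') * (2 * M ^ 3)"
    using M(1) self_le_power[of M 3] by (intro mult_left_mono) auto
  ultimately show ?thesis
    unfolding s_def by (simp add: algebra_simps power2_eq_square power3_eq_cube)
qed

text \<open>The letters mean the same as before. The difference is
  \<open>p * (q' - w * u') - (v - p * w) * u'\<close>, and
  \<open>q' - w * u' = q' * (u - q * w) * u'\<close> exposes the other error. Both \<open>p\<close>
  and \<open>q'\<close> are bounded by \<open>2 * M\<^sup>2\<close>, which together with
  \<open>norm u' \<le> M\<close> produces \<open>4 * M ^ 5\<close>.\<close>

lemma product_error_le_KH_error:
  fixes u v w u' w' p q q' :: "'a::real_normed_algebra_1"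
  assumes inv: "u * u' = 1" "w * w' = 1" "q' * q = 1"
    and M: "M \<ge> 1" "norm w \<le> M" "norm v \<le> M" "norm u' \<le> M" "norm w' \<le> M"
    and small: "norm (u - q * w) \<le> 1 / (2 * M\<^sup>2)" "norm (v - p * w) \<le> 1 / (2 * M\<^sup>2)"
  shows "norm (p * q' - v * u')
    \<le> 4 * M ^ 5 * (norm (u - q * w) + norm (v - p * w))"
proof -
  define s where "s = u - q * w"
  have r: "1 / (2 * M\<^sup>2) \<le> 1 / 2" "1 / (2 * M\<^sup>2) * M \<le> 1 / 2"
    using M(1) mult_mono[of 1 M 1 M] by (auto simp: field_simps power2_eq_square)
  have q's: "q' * (s * u') = q' - w * u'"
  proof -
    have "q' * (s * u') = q' * (u * u') - (q' * q) * w * u'"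
      by (simp add: s_def algebra_simps)
    then show ?thesis by (simp add: inv)
  qed
  have "norm (s * u') \<le> 1 / 2"
    using norm_mult_bound[OF small(1)[folded s_def] M(4)] r(2) by linarith
  moreover have "q' = w * u' + q' * (s * u')" using q's by simp
  ultimately have "norm q' \<le> 2 * (M * M)"
    using norm_le_absorb[of q' "w * u'"] norm_mult_bound[OF M(2,4)] by fastforce
  moreover have "norm p \<le> (M + 1) * M"
  proof -
    \<comment> \<open>The product \<open>p * w\<close> is close to \<open>v\<close>, and
      \<open>w'\<close> on the right recovers \<open>p\<close> from it.\<close>
    have "p = (v - (v - p * w)) * w'" by (simp add: mult.assoc inv)
    moreover have "norm (v - (v - p * w)) \<le> M + 1"
      using norm_triangle_ineq4[of v "v - p * w"] M(3) small(2) r(1) by linarith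
    ultimately show ?thesis using norm_mult_bound[OF _ M(5)] by metis
  qed
  moreover have "(M + 1) * M \<le> 2 * M * M" using M(1) by (intro mult_right_mono) auto
  ultimately have "norm (p * q' * s * u') \<le> 2 * M * M * (2 * (M * M)) * norm s * M"
    by (intro norm_mult_bound M) auto
  moreover have "norm ((v - p * w) * u') \<le> norm (v - p * w) * M"
    by (intro norm_mult_bound M) auto
  moreover have "p * q' - v * u' = p * q' * s * u' - (v - p * w) * u'"
  proof -
    have "p * q' * s * u' = p * (q' - w * u')" using q's by (simp add: mult.assoc)
    then show ?thesis by (simp add: algebra_simps)
  qed
  ultimately have "norm (p * q' - v * u')
      \<le> 2 * M * M * (2 * (M * M)) * norm s * M + norm (v - p * w) * M"
    using norm_triangle_ineq4[of "p * q' * s * u'" "(v - p * w) * u'"] by simp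
  also have "2 * M * M * (2 * (M * M)) * norm s * M = 4 * M ^ 5 * norm s"
    by (simp add: power_numeral_reduce)
  also have "norm (v - p * w) * M \<le> norm (v - p * w) * (4 * M ^ 5)"
    using M(1) self_le_power[of M 5] by (intro mult_left_mono) auto
  finally show ?thesis
    by (simp add: s_def algebra_simps)
qed

theorem theorem8p9:
  fixes a b :: real
    and A :: "real \<Rightarrow> 'a::{real_normed_algebra_1,banach}"
    and V :: "real \<Rightarrow> real set \<Rightarrow> 'a"
  assumes "a < b"
    and "regulated_on a b A"
    and "\<And>t. t \<in> {a..<b} \<Longrightarrow> invertible_elt (1 + right_jump A t)"
    and "\<And>t. t \<in> {a<..b} \<Longrightarrow> invertible_elt (1 - left_jump A t)"
    and "\<And>\<xi> x y. \<lbrakk>\<xi> \<in> {a..b}; a \<le> x; x \<le> y; y \<le> b; invertible_elt (1 + A x - A \<xi>)\<rbrakk>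
           \<Longrightarrow> V \<xi> {x..y} = (1 + A y - A \<xi>) * inverse_elt (1 + A x - A \<xi>)"
  shows "strongly_Kurzweil_product_integrable a b V \<longleftrightarrow>
         (\<exists>W. strong_KH_solution a b A W \<and>
              (\<forall>t\<in>{a..b}. invertible_elt (W t)) \<and>
              bounded (W ` {a..b}) \<and>
              bounded ((\<lambda>t. inverse_elt (W t)) ` {a..b}))"
proof -
  let ?I = inverse_elt
  obtain \<delta>\<^sub>0 where \<delta>\<^sub>0: "gauge_on a b \<delta>\<^sub>0"
    "\<And>s x. \<lbrakk>s \<in> {a..b}; a \<le> x; x \<le> s; s - \<delta>\<^sub>0 s < x\<rbrakk> \<Longrightarrow> invertible_elt (1 + A x - A s)"
    using regulated_on_gauge_invertible[OF assms(2,4)] by blast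
  \<comment> \<open>When the tag is an endpoint, one factor of \<open>V\<close> is \<open>1\<close>:
    the right half shows only \<open>P\<close>, the left half only the inverse of
    \<open>Q\<close>.\<close>
  have V_right: "V s {s..y} = 1 + A y - A s" if "s \<in> {a..b}" "s \<le> y" "y \<le> b" for s y
    using assms(5)[of s s y] that by (simp add: invertible_elt_one inverse_elt_one)
  have V_left: "V s {x..s} = ?I (1 + A x - A s)"
    if "s \<in> {a..b}" "a \<le> x" "x \<le> s" "s - \<delta>\<^sub>0 s < x" for s x
    using assms(5)[of s x s] \<delta>\<^sub>0(2)[of s x] that by simp
  define prod_err where "prod_err = (\<lambda>W s x y. norm (V s {x..y} - W y * ?I (W x)))"
  define KH_err where "KH_err = (\<lambda>W s x y. norm (W y - W x - (A y - A x) * W s))"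
  \<comment> \<open>The same \<open>W\<close> serves in both conditions, so they can be compared for
    each admissible \<open>W\<close> separately.\<close>
  have equiv: "null_sums a b (prod_err W) \<longleftrightarrow> null_sums a b (KH_err W)"
    if W: "\<forall>t\<in>{a..b}. invertible_elt (W t)" "bounded (W ` {a..b})"
      "bounded ((\<lambda>t. ?I (W t)) ` {a..b})" for W
  proof -
    obtain M where M: "M \<ge> 1" "\<And>t. t \<in> {a..b} \<Longrightarrow> norm (W t) \<le> M"
      "\<And>t. t \<in> {a..b} \<Longrightarrow> norm (?I (W t)) \<le> M"
      using bounded_images_common_bound[OF W(2,3)] by blast
    have inv: "W t * ?I (W t) = 1" "?I (W t) * W t = 1" if "t \<in> {a..b}" for t
      using W(1) inverse_elt[of "W t"] that by auto
    have r: "1 / (2 * M\<^sup>2) > 0" using M(1) by simp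
    show ?thesis
    proof
      assume L: "null_sums a b (prod_err W)"
      show "null_sums a b (KH_err W)"
      proof (rule null_sums_transfer[where r = "1 / (2 * M\<^sup>2)" and C = "2 * M ^ 3", OF L _ _ \<delta>\<^sub>0(1) r])
        show "prod_err W s s s = 0" if "s \<in> {a..b}" for s
          using V_right[of s s] that by (simp add: prod_err_def inv)
        fix s x y
        assume *: "a \<le> x" "x \<le> s" "s \<le> y" "y \<le> b" "s - \<delta>\<^sub>0 s < x"
          and small: "prod_err W s x s \<le> 1 / (2 * M\<^sup>2)"
        let ?P = "1 + A y - A s" and ?Q = "1 + A x - A s"
        have mem: "x \<in> {a..b}" "s \<in> {a..b}" "y \<in> {a..b}" using * by auto
        have errs: "prod_err W s x s = norm (?I ?Q - W s * ?I (W x))"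
          "prod_err W s s y = norm (?P - W y * ?I (W s))"
          using V_left[of s x] V_right[of s y] * mem by (auto simp: prod_err_def)
        have "KH_err W s x y = norm (W y - W x - (?P - ?Q) * W s)"
          by (simp add: KH_err_def)
        also have "\<dots> \<le> 2 * M ^ 3 * (norm (?I ?Q - W s * ?I (W x)) + norm (?P - W y * ?I (W s)))"
          by (intro KH_error_le_product_error inv mem M inverse_elt \<delta>\<^sub>0(2) *
              small[unfolded errs])
        finally show "KH_err W s x y \<le> 2 * M ^ 3 * (prod_err W s x s + prod_err W s s y)"
          unfolding errs .
      qed (use M(1) in \<open>auto simp: prod_err_def\<close>)
    next
      assume L: "null_sums a b (KH_err W)"
      show "null_sums a b (prod_err W)"
      proof (rule null_sums_transfer[where r = "1 / (2 * M\<^sup>2)" and C = "4 * M ^ 5", OF L _ _ \<delta>\<^sub>0(1) r])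
        fix s x y
        assume *: "a \<le> x" "x \<le> s" "s \<le> y" "y \<le> b" "s - \<delta>\<^sub>0 s < x"
          and small: "KH_err W s x s \<le> 1 / (2 * M\<^sup>2)" "KH_err W s s y \<le> 1 / (2 * M\<^sup>2)"
        let ?P = "1 + A y - A s" and ?Q = "1 + A x - A s"
        have mem: "x \<in> {a..b}" "s \<in> {a..b}" "y \<in> {a..b}" using * by auto
        have Q: "invertible_elt ?Q" using \<delta>\<^sub>0(2) * mem by auto
        \<comment> \<open>On the left half the increment runs from \<open>x\<close> to the tag, so
          its error is \<open>- (W x - ?Q * W s)\<close>; the norm removes the sign.\<close>
        have errs: "KH_err W s x s = norm (W x - ?Q * W s)" "KH_err W s s y = norm (W y - ?P * W s)"
          unfolding KH_err_def
          by (subst norm_minus_cancel[symmetric], simp add: algebra_simps) (simp add: algebra_simps)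
        have "prod_err W s x y = norm (?P * ?I ?Q - W y * ?I (W x))"
          using assms(5)[of s x y] * mem Q by (simp add: prod_err_def)
        also have "\<dots> \<le> 4 * M ^ 5 * (norm (W x - ?Q * W s) + norm (W y - ?P * W s))"
          by (intro product_error_le_KH_error[where w' = "?I (W s)"] inv mem M
              inverse_elt Q small[unfolded errs])
        finally show "prod_err W s x y \<le> 4 * M ^ 5 * (KH_err W s x s + KH_err W s s y)"
          unfolding errs .
      qed (use M(1) in \<open>auto simp: KH_err_def\<close>)
    qed
  qed
  have "strongly_Kurzweil_product_integrable a b V \<longleftrightarrow>
      (\<exists>W. (\<forall>t\<in>{a..b}. invertible_elt (W t)) \<and> bounded (W ` {a..b}) \<and>
           bounded ((\<lambda>t. ?I (W t)) ` {a..b}) \<and> null_sums a b (prod_err W))"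
    unfolding strongly_Kurzweil_product_integrable_def null_sums_def partition_sum_def
      prod_err_def ..
  moreover have "strong_KH_solution a b A W \<longleftrightarrow> null_sums a b (KH_err W)" for W
    unfolding strong_KH_solution_def null_sums_def partition_sum_def KH_err_def ..
  ultimately show ?thesis using equiv by blast
qed

end
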